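(* Let $\mathfrak g$ be a type-$A$ Frobenius seaweed with principal multiplicities $h_j$ whose positive Ooms support $\{j\ge1:h_j\ne0\}$ is $\{1,\ldots,N\}$, and put $p_m=h_m-h_{m+1}$ for $1\le m\le N$, where $h_{N+1}=0$. Then $$\Theta_{\mathfrak g}=\sum_{m=1}^{N}p_m\,\chi_{2m-1},\qquad h_j=\sum_{m=j}^{N}p_m>0\quad(1\le j\le N).$$ Equivalently, the centered principal character $\Theta_{\mathfrak g}$ has every odd weight from $-(2N-1)$ to $2N-1$ (each such weight occurs with nonzero multiplicity). Thus unbrokenness of the Ooms support amounts to the strict positivity of all tail sums $\sum_{m=j}^N p_m$, $1\le j\le N$, whereas strict unimodality of the Ooms spectrum is the stronger condition $p_m>0$ for every $1\le m\le N$.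
   Context: All Lie algebras are finite-dimensional over $\mathbb C$. A Lie algebra $\mathfrak g$ is Frobenius if there is $F\in\mathfrak g^*$ whose Kirillov form $B_F(x,y)=F([x,y])$ is nondegenerate; the principal element $H=\widehat F$ is the unique element with $F([H,x])=F(x)$ for all $x$. For type-$A$ seaweeds $\operatorname{ad}H$ is semisimple with integral eigenvalues; $\mathfrak g_j=\{x:[H,x]=jx\}$, and the principal multiplicities $h_j=\dim\mathfrak g_j$ are independent of $F$ and satisfy $h_{1-j}=h_j$. The multiset of eigenvalues is the Ooms spectrum; it is strictly unimodal if $h_1>h_2>\cdots>h_N>0$ with $N$ the largest eigenvalue. A type-$A$ seaweed is an algebra $$\mathfrak q(A\mid B)=\mathfrak h\oplus\bigoplus_{i>j,\ \alpha(i)=\alpha(j)}\mathbb C E_{ij}\oplus\bigoplus_{i<j,\ \beta(i)=\beta(j)}\mathbb C E_{ij}\subseteq\mathfrak{sl}_n,$$ where $A,B$ are compositions of $n$ cutting $1,\ldots,n$ into consecutive blocks, $\alpha(i)$ and $\beta(i)$ are the $A$-block and $B$-block containing $i$, and $\mathfrak h$ is the trace-zero diagonal subalgebra. The centered principal character is $\Theta_{\mathfrak g}(x)=\sum_j h_jx^{2j-1}$, and $\chi_n(x)=x^n+x^{n-2}+\cdots+x^{-n}$ is the character of the $SL_2$-module $\operatorname{Sym}^n(\mathbb C^2)$. *)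

theory Defs
  imports "HOL-Analysis.Analysis" "HOL-Library.Poly_Mapping"
begin

section \<open>Complex matrices as a Lie algebra\<close>

text \<open>
  The type \<open>complex^'n^'n\<close> is regarded as a vector space over the complex numbers
  (not over the reals), so that \<open>cmat.span\<close> and \<open>cmat.dim\<close> are taken over the complex
  numbers.
\<close>

definition mscale :: "complex \<Rightarrow> complex^'n^'m \<Rightarrow> complex^'n^'m" where
  "mscale c M = (\<chi> i j. c * M $ i $ j)"

global_interpretation cmat: vector_space "mscale :: complex \<Rightarrow> complex^'n^'m \<Rightarrow> complex^'n^'m"
  by unfold_locales (simp_all add: mscale_def vec_eq_iff algebra_simps)

definition bracket :: "complex^'n^'n \<Rightarrow> complex^'n^'n \<Rightarrow> complex^'n^'n" where
  "bracket x y = x ** y - y ** x"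

definition matrix_unit :: "'n \<Rightarrow> 'n \<Rightarrow> complex^'n^'n" where
  "matrix_unit i j = (\<chi> k l. if k = i \<and> l = j then 1 else 0)"


section \<open>Type-A seaweeds\<close>

definition composition :: "nat \<Rightarrow> nat list \<Rightarrow> bool" where
  "composition n A \<longleftrightarrow> (\<forall>a \<in> set A. 0 < a) \<and> sum_list A = n"

text \<open>
  \<open>block_of A r\<close> is the (0-based) number of the block containing the (0-based) position \<open>r\<close>
  when the positions are cut into consecutive blocks of sizes \<open>A ! 0, A ! 1, \<dots>\<close>.
\<close>

fun block_of :: "nat list \<Rightarrow> nat \<Rightarrow> nat" where
  "block_of [] r = 0"
| "block_of (a # A) r = (if r < a then 0 else Suc (block_of A (r - a)))"

text \<open>
  Matrix indices range over an arbitrary finite linearly ordered type, which plays the role of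
  \<open>1, \<dots>, n\<close> with \<open>n = CARD('n)\<close>; the 0-based position of the index \<open>i\<close> is the number of
  indices below it.
\<close>

definition same_block :: "nat list \<Rightarrow> 'n::{finite,linorder} \<Rightarrow> 'n \<Rightarrow> bool" where
  "same_block A i j \<longleftrightarrow> block_of A (card {..<i}) = block_of A (card {..<j})"

definition traceless_diagonal :: "(complex^'n^'n) set" where
  "traceless_diagonal = {M. (\<forall>i j. i \<noteq> j \<longrightarrow> M $ i $ j = 0) \<and> trace M = 0}"

text \<open>The synonym allows stating the order constraint on the index type.\<close>

type_synonym 'n cmatrix = "complex^'n^'n"

definition seaweed :: "nat list \<Rightarrow> nat list \<Rightarrow> ('n::{finite,linorder}) cmatrix set" where
  "seaweed A B = cmat.span (traceless_diagonal
      \<union> {matrix_unit i j | i j. i > j \<and> same_block A i j}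
      \<union> {matrix_unit i j | i j. i < j \<and> same_block B i j})"


section \<open>Frobenius Lie algebras and principal multiplicities\<close>

text \<open>
  Lie algebras are given as sets \<open>g\<close> of matrices. A functional on \<open>g\<close> is a function on all
  matrices of which only the values on \<open>g\<close> matter.
\<close>

definition functional_on :: "(complex^'n^'n) set \<Rightarrow> (complex^'n^'n \<Rightarrow> complex) \<Rightarrow> bool" where
  "functional_on g F \<longleftrightarrow>
     (\<forall>x\<in>g. \<forall>y\<in>g. F (x + y) = F x + F y) \<and> (\<forall>c. \<forall>x\<in>g. F (mscale c x) = c * F x)"

definition kirillov :: "(complex^'n^'n \<Rightarrow> complex) \<Rightarrow> complex^'n^'n \<Rightarrow> complex^'n^'n \<Rightarrow> complex" where
  "kirillov F x y = F (bracket x y)"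

text \<open>The Kirillov form is alternating, so the left radical suffices for nondegeneracy.\<close>

definition Frobenius_functional :: "(complex^'n^'n) set \<Rightarrow> (complex^'n^'n \<Rightarrow> complex) \<Rightarrow> bool" where
  "Frobenius_functional g F \<longleftrightarrow>
     functional_on g F \<and> (\<forall>x\<in>g. (\<forall>y\<in>g. kirillov F x y = 0) \<longrightarrow> x = 0)"

definition Frobenius :: "(complex^'n^'n) set \<Rightarrow> bool" where
  "Frobenius g \<longleftrightarrow> (\<exists>F. Frobenius_functional g F)"

definition principal_element :: "(complex^'n^'n) set \<Rightarrow> (complex^'n^'n \<Rightarrow> complex) \<Rightarrow> complex^'n^'n" where
  "principal_element g F = (THE H. H \<in> g \<and> (\<forall>x\<in>g. F (bracket H x) = F x))"

definition principal_eigenspace ::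
    "(complex^'n^'n) set \<Rightarrow> (complex^'n^'n \<Rightarrow> complex) \<Rightarrow> int \<Rightarrow> (complex^'n^'n) set" where
  "principal_eigenspace g F j =
     {x \<in> g. bracket (principal_element g F) x = mscale (of_int j) x}"

definition principal_multiplicity ::
    "(complex^'n^'n) set \<Rightarrow> (complex^'n^'n \<Rightarrow> complex) \<Rightarrow> int \<Rightarrow> nat" where
  "principal_multiplicity g F j = cmat.dim (principal_eigenspace g F j)"


section \<open>The Ooms spectrum\<close>

text \<open>
  The spectrum of a type-A Frobenius seaweed consists of integers and is recorded by its
  multiplicity function \<open>h\<close>, where \<open>h j\<close> is the multiplicity of the eigenvalue \<open>j\<close>.
\<close>

definition positive_support :: "(int \<Rightarrow> nat) \<Rightarrow> int set" where
  "positive_support h = {j. 1 \<le> j \<and> h j \<noteq> 0}"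

definition unbroken :: "(int \<Rightarrow> nat) \<Rightarrow> bool" where
  "unbroken h \<longleftrightarrow> (\<exists>N::nat. positive_support h = {1..int N})"

text \<open>
  \<open>N\<close> is the largest eigenvalue; \<open>N = 0\<close> also covers the empty spectrum of the zero algebra
  (the only seaweed in size 1).
\<close>

definition largest_eigenvalue :: "(int \<Rightarrow> nat) \<Rightarrow> nat \<Rightarrow> bool" where
  "largest_eigenvalue h N \<longleftrightarrow> (\<forall>j > int N. h j = 0) \<and> (0 < N \<longrightarrow> h (int N) \<noteq> 0)"

definition strictly_unimodal :: "(int \<Rightarrow> nat) \<Rightarrow> bool" where
  "strictly_unimodal h \<longleftrightarrow>
     (\<exists>N. largest_eigenvalue h N \<and> (\<forall>j. 1 \<le> j \<and> j < int N \<longrightarrow> h j > h (j + 1))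
        \<and> (0 < N \<longrightarrow> h (int N) > 0))"


section \<open>Characters\<close>

text \<open>
  Laurent polynomials in \<open>x\<close> with integer coefficients are the finitely supported functions
  \<open>int \<Rightarrow>\<^sub>0 int\<close> under convolution: \<open>Poly_Mapping.single k c\<close> is \<open>c x\<^sup>k\<close>, and
  \<open>Poly_Mapping.keys\<close> is the set of weights occurring with nonzero multiplicity.
\<close>

definition Theta :: "(int \<Rightarrow> nat) \<Rightarrow> int \<Rightarrow>\<^sub>0 int" where
  "Theta h = (\<Sum>j | h j \<noteq> 0. Poly_Mapping.single (2 * j - 1) (int (h j)))"

definition sl2_char :: "nat \<Rightarrow> int \<Rightarrow>\<^sub>0 int" where
  "sl2_char n = (\<Sum>k = 0..n. Poly_Mapping.single (int n - 2 * int k) 1)"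

definition has_odd_weights :: "(int \<Rightarrow>\<^sub>0 int) \<Rightarrow> nat \<Rightarrow> bool" where
  "has_odd_weights \<theta> N \<longleftrightarrow>
     (\<forall>w. odd w \<and> - (2 * int N - 1) \<le> w \<and> w \<le> 2 * int N - 1 \<longrightarrow> w \<in> Poly_Mapping.keys \<theta>)"

end

theory Submission
  imports Defs
begin

text \<open>
  Everything follows from the symmetry \<open>h (1 - j) = h j\<close> of the multiplicities.  Together with a bound on the positive support it confines the
  spectrum to \<open>1 - N, \<dots>, N\<close>, so the weights of the centered character are odd and symmetric
  under \<open>w \<mapsto> -w\<close>.  Peeling off such a symmetric character in layers, the layer of thickness
  \<open>p m = h m - h (m + 1)\<close> is supported on \<open>1 - m, \<dots>, m\<close>, that is, it is \<open>p m\<close> copies of the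
  irreducible character with highest weight \<open>2 * m - 1\<close>.  The tail sums of \<open>p\<close> telescope back
  to \<open>h\<close>; hence unbrokenness, positivity of the tail sums and presence of all odd weights
  all say that \<open>h\<close> does not vanish on \<open>1, \<dots>, N\<close>.

  The symmetry itself (\<open>principal_multiplicity_symmetric\<close>) comes from the Kirillov form.
  Since \<open>F ([H, z]) = F z\<close>, the Leibniz rule applied to \<open>z = [x, y]\<close> gives
  \<open>B ([H, x], y) + B (x, [H, y]) = B (x, y)\<close>, so \<open>ad H - j\<close> and \<open>(1 - j) - ad H\<close> are adjoint
  with respect to the nondegenerate form \<open>B\<close>, and the kernels of adjoint endomorphisms have the
  same dimension.  This yields eigenspaces of equal dimension directly, without
  diagonalising \<open>ad H\<close> or splitting the algebra into weight spaces.

  Both the existence of \<open>H\<close> and the restriction of \<open>ad H\<close> to the seaweed rest on the seaweed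
  being a Lie algebra: the matrix positions where its elements may be nonzero form a preorder
  (\<open>seaweed_position_trans\<close>), so it is the trace-zero part of an incidence algebra.
\<close>


section \<open>Forms on a finite-dimensional subspace\<close>

context finite_dimensional_vector_space
begin

lemma rank_nullity_on_subspace:
  assumes f: "Vector_Spaces.linear scale scale f" and V: "subspace V"
  shows "dim {x \<in> V. f x = 0} + dim (f ` V) = dim V"
proof -
  interpret pair: finite_dimensional_vector_space_pair scale Basis scale Basis
    by unfold_locales
  interpret f: Vector_Spaces.linear scale scale f by fact
  let ?K = "{x \<in> V. f x = 0}"
  obtain BK where BK: "BK \<subseteq> ?K" "independent BK" "?K \<subseteq> span BK" "card BK = dim ?K"
    by (rule basis_exists)
  obtain BV where BV: "BK \<subseteq> BV" "BV \<subseteq> V" "independent BV" "V \<subseteq> span BV"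
    using maximal_independent_subset_extend[of BK V] BK by blast
  have fin: "finite BV" using BV(3) by (rule finiteI_independent)
  \<comment> \<open>the span of \<open>L\<close> is a complement of the kernel in \<open>V\<close>, and \<open>f\<close> maps it bijectively onto \<open>f ` V\<close>\<close>
  define L where "L = BV - BK"
  have L: "independent L" unfolding L_def using BV(3) by (rule independent_mono) auto
  have spanL: "span L \<subseteq> V"
    using BV(2) V by (metis Diff_subset L_def order_trans span_minimal)
  have zero: "x = 0" if x: "x \<in> span L" and fx: "f x = 0" for x
  proof -
    have "x \<in> span BK" using BK(3) spanL x fx by blast
    then have "x \<in> span L \<inter> span BK" using x by blast
    moreover have "span L \<inter> span BK = {0}"
    proof -
      have "representation BV x = (\<lambda>_. 0)" if "x \<in> span L" "x \<in> span BK" for x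
      proof
        fix b
        have "representation BV x = representation L x"
          using representation_extend[OF BV(3) that(1)] by (simp add: L_def)
        moreover have "representation BV x = representation BK x"
          using representation_extend[OF BV(3) that(2) BV(1)] .
        ultimately show "representation BV x b = 0"
          using representation_ne_zero[of L x b] representation_ne_zero[of BK x b]
          by (auto simp: L_def)
      qed
      moreover have "x = 0" if "x \<in> span L" "representation BV x = (\<lambda>_. 0)" for x
        using sum_nonzero_representation_eq[OF BV(3), of x] that spanL BV(4) by auto
      ultimately show ?thesis by (auto simp: span_zero)
    qed
    ultimately show ?thesis by auto
  qed
  have inj: "inj_on f (span L)"
    using pair.linear_inj_on_iff_eq_0[OF f subspace_span[of L]] zero by blast
  have "f ` V = f ` span L"
  proof
    show "f ` V \<subseteq> f ` span L"
    proof
      fix y assume "y \<in> f ` V"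
      then obtain x where x: "x \<in> V" "y = f x" by blast
      have "BV = BK \<union> L" using BV(1) L_def by auto
      then have "x \<in> span (BK \<union> L)" using BV(4) x by auto
      then obtain k l where kl: "x = k + l" "k \<in> span BK" "l \<in> span L"
        unfolding span_Un by auto
      have "subspace ?K"
        using V by (auto simp: subspace_def f.add f.scale f.zero)
      then have "k \<in> ?K" using kl(2) BK(1) span_minimal by blast
      then show "y \<in> f ` span L" using kl x by (auto simp: f.add)
    qed
  qed (use spanL in auto)
  then have "dim (f ` V) = card L"
    using pair.dim_image_eq[OF f, of "span L"] inj dim_span_eq_card_independent[OF L]
    by (simp add: span_span)
  moreover have "dim V = card BV" using basis_card_eq_dim[OF BV(2,4,3)] by simp
  ultimately show ?thesis
    using BK(4) BV(1) fin card_Diff_subset[of BK BV] card_mono[OF fin BV(1)]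
    by (simp add: L_def finite_subset)
qed

text \<open>
  A basis \<open>E\<close> of \<open>V\<close> identifies the dual of \<open>V\<close> with \<open>V\<close> itself, a functional \<open>\<phi>\<close> becoming
  the vector with coordinates \<open>\<phi> e\<close>.  In this encoding the map \<open>x \<mapsto> \<beta> x\<close> to the dual is an
  endomorphism, so that the dimension theory of a single space applies to it.
\<close>

lemma dual_coordinates:
  assumes lin: "\<And>y. Vector_Spaces.linear scale (*) (\<lambda>x. \<beta> x y)"
    and linr: "\<And>x. Vector_Spaces.linear scale (*) (\<beta> x)"
    and nondeg: "\<And>x. x \<in> V \<Longrightarrow> (\<forall>y\<in>V. \<beta> x y = 0) \<Longrightarrow> x = 0"
    and V: "subspace V"
    and E: "independent E" "E \<subseteq> V" "V \<subseteq> span E"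
  shows "Vector_Spaces.linear scale scale (\<lambda>x. \<Sum>e\<in>E. scale (\<beta> x e) e)"
    and "inj_on (\<lambda>x. \<Sum>e\<in>E. scale (\<beta> x e) e) V"
proof -
  interpret pair: vector_space_pair scale scale by unfold_locales
  interpret fun_pair: vector_space_pair scale "(*) :: 'a \<Rightarrow> 'a \<Rightarrow> 'a" by unfold_locales
  let ?\<Phi> = "\<lambda>x. \<Sum>e\<in>E. scale (\<beta> x e) e"
  have fin: "finite E" using E(1) by (rule finiteI_independent)
  have add: "\<beta> (x + x') y = \<beta> x y + \<beta> x' y" and sc: "\<beta> (scale c x) y = c * \<beta> x y" for x x' y c
    using fun_pair.linear_add[OF lin] fun_pair.linear_scale[OF lin] by blast+
  show lin\<Phi>: "Vector_Spaces.linear scale scale ?\<Phi>"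
    unfolding Vector_Spaces.linear_iff using vector_space_axioms
    by (simp add: add sc scale_left_distrib sum.distrib scale_sum_right)
  have "x = 0" if x: "x \<in> V" "?\<Phi> x = 0" for x
  proof (rule nondeg[OF x(1)])
    have "\<beta> x e = 0" if "e \<in> E" for e
      using independentD[OF E(1) fin _ x(2) that] by blast
    then have "\<beta> x y = 0" if "y \<in> span E" for y
      using fun_pair.linear_eq_0_on_span[OF linr[of x] _ that] by blast
    then show "\<forall>y\<in>V. \<beta> x y = 0" using E(3) by blast
  qed
  then show "inj_on ?\<Phi> V"
    using pair.linear_inj_on_iff_eq_0[OF lin\<Phi> V] by blast
qed

text \<open>
  Choose the basis of \<open>V\<close> to extend one of \<open>W\<close>: a vector annihilating \<open>W\<close> has dual coordinates
  only along the remaining basis vectors.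
\<close>

lemma dim_annihilator_le:
  assumes lin: "\<And>y. Vector_Spaces.linear scale (*) (\<lambda>x. \<beta> x y)"
    and linr: "\<And>x. Vector_Spaces.linear scale (*) (\<beta> x)"
    and nondeg: "\<And>x. x \<in> V \<Longrightarrow> (\<forall>y\<in>V. \<beta> x y = 0) \<Longrightarrow> x = 0"
    and V: "subspace V" and W: "W \<subseteq> V"
  shows "dim {x \<in> V. \<forall>w\<in>W. \<beta> x w = 0} + dim W \<le> dim V"
proof -
  interpret pair: finite_dimensional_vector_space_pair scale Basis scale Basis
    by unfold_locales
  interpret fun_pair: vector_space_pair scale "(*) :: 'a \<Rightarrow> 'a \<Rightarrow> 'a" by unfold_locales
  let ?P = "{x \<in> V. \<forall>w\<in>W. \<beta> x w = 0}"
  obtain D where D: "D \<subseteq> W" "independent D" "W \<subseteq> span D" "card D = dim W"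
    by (rule basis_exists)
  obtain E where E: "D \<subseteq> E" "E \<subseteq> V" "independent E" "V \<subseteq> span E"
    using maximal_independent_subset_extend[of D V] D W by blast
  have fin: "finite E" using E(3) by (rule finiteI_independent)
  define \<Phi> where "\<Phi> x = (\<Sum>e\<in>E. scale (\<beta> x e) e)" for x
  note dual = dual_coordinates[OF lin linr nondeg V E(3,2,4), folded \<Phi>_def]
  have "subspace ?P"
    using V fun_pair.linear_add[OF lin] fun_pair.linear_scale[OF lin] fun_pair.linear_0[OF lin]
    by (auto simp: subspace_def)
  then have spanP: "span ?P = ?P" by (rule span_eq_iff[THEN iffD2])
  have "inj_on \<Phi> (span ?P)"
    unfolding spanP by (rule inj_on_subset[OF dual(2)]) auto
  then have "dim ?P = dim (\<Phi> ` ?P)" using pair.dim_image_eq[OF dual(1), of ?P] by simp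
  also have "\<dots> \<le> dim (E - D)"
  proof (rule dim_mono, rule image_subsetI)
    fix x assume x: "x \<in> ?P"
    have "\<Phi> x = (\<Sum>e\<in>E - D. scale (\<beta> x e) e)"
      unfolding \<Phi>_def by (rule sum.mono_neutral_right) (use fin x D(1) in auto)
    then show "\<Phi> x \<in> span (E - D)" by (auto intro: span_sum span_scale span_base)
  qed
  also have "\<dots> = card (E - D)"
    by (rule dim_eq_card_independent, rule independent_mono[OF E(3)]) auto
  also have "\<dots> = dim V - dim W"
    using card_Diff_subset[of D E] E(1) fin D(4) basis_card_eq_dim[OF E(2,4,3)]
    by (simp add: finite_subset)
  finally show ?thesis using dim_subset[OF W] by simp
qed

text \<open>
  An injective endomorphism of a finite-dimensional space is onto; for the map to dual
  coordinates this represents every functional by a vector.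
\<close>

lemma functional_represented:
  assumes lin: "\<And>y. Vector_Spaces.linear scale (*) (\<lambda>x. \<beta> x y)"
    and linr: "\<And>x. Vector_Spaces.linear scale (*) (\<beta> x)"
    and nondeg: "\<And>x. x \<in> V \<Longrightarrow> (\<forall>y\<in>V. \<beta> x y = 0) \<Longrightarrow> x = 0"
    and V: "subspace V" and \<phi>: "Vector_Spaces.linear scale (*) \<phi>"
  obtains z where "z \<in> V" "\<And>y. y \<in> V \<Longrightarrow> \<beta> z y = \<phi> y"
proof -
  interpret pair: finite_dimensional_vector_space_pair scale Basis scale Basis
    by unfold_locales
  interpret fun_pair: vector_space_pair scale "(*) :: 'a \<Rightarrow> 'a \<Rightarrow> 'a" by unfold_locales
  obtain E where E: "E \<subseteq> V" "independent E" "V \<subseteq> span E" "card E = dim V"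
    by (rule basis_exists)
  have fin: "finite E" using E(2) by (rule finiteI_independent)
  define \<Phi> where "\<Phi> x = (\<Sum>e\<in>E. scale (\<beta> x e) e)" for x
  note dual = dual_coordinates[OF lin linr nondeg V E(2,1,3), folded \<Phi>_def]
  have spanV: "span V = V" using V by (rule span_eq_iff[THEN iffD2])
  have inV: "(\<Sum>e\<in>E. scale (u e) e) \<in> V" for u
    using V E(1) by (auto intro!: subspace_sum subspace_scale)
  have "\<Phi> ` V = V"
  proof (rule subspace_dim_equal)
    show "subspace (\<Phi> ` V)" by (rule pair.linear_subspace_image[OF dual(1) V])
    show "\<Phi> ` V \<subseteq> V" using inV by (auto simp: \<Phi>_def)
    show "dim V \<le> dim (\<Phi> ` V)"
      using pair.dim_image_eq[OF dual(1), of V] dual(2) spanV by simp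
  qed (fact V)
  with inV[of \<phi>] have "(\<Sum>e\<in>E. scale (\<phi> e) e) \<in> \<Phi> ` V" by simp
  then obtain z where z: "(\<Sum>e\<in>E. scale (\<phi> e) e) = \<Phi> z" "z \<in> V"
    by (rule imageE)
  have "(\<Sum>e\<in>E. scale (\<beta> z e - \<phi> e) e) = 0"
    using z(1) by (simp add: \<Phi>_def scale_left_diff_distrib sum_subtractf)
  then have "\<beta> z e - \<phi> e = 0" if "e \<in> E" for e
    using independentD[OF E(2) fin _ _ that, of "\<lambda>e. \<beta> z e - \<phi> e"] by blast
  then have "\<beta> z y = \<phi> y" if "y \<in> span E" for y
    using fun_pair.linear_eq_on_span[OF linr[of z] \<phi> _ that] by simp
  then show ?thesis using that[OF z(2)] E(3) by blast
qed

text \<open>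
  A vector in the kernel of \<open>T\<close> annihilates the image of the adjoint \<open>S\<close>, and the codimension of
  that image is the dimension of the kernel of \<open>S\<close>.
\<close>

lemma dim_kernel_le_adjoint:
  assumes lin: "\<And>y. Vector_Spaces.linear scale (*) (\<lambda>x. \<beta> x y)"
    and linr: "\<And>x. Vector_Spaces.linear scale (*) (\<beta> x)"
    and nondeg: "\<And>x. x \<in> V \<Longrightarrow> (\<forall>y\<in>V. \<beta> x y = 0) \<Longrightarrow> x = 0"
    and V: "subspace V"
    and S: "Vector_Spaces.linear scale scale S" "S ` V \<subseteq> V"
    and adj: "\<And>x y. x \<in> V \<Longrightarrow> y \<in> V \<Longrightarrow> \<beta> (T x) y = \<beta> x (S y)"
  shows "dim {x \<in> V. T x = 0} \<le> dim {x \<in> V. S x = 0}"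
proof -
  interpret fun_pair: vector_space_pair scale "(*) :: 'a \<Rightarrow> 'a \<Rightarrow> 'a" by unfold_locales
  have "{x \<in> V. T x = 0} \<subseteq> {x \<in> V. \<forall>w\<in>S ` V. \<beta> x w = 0}"
    using adj fun_pair.linear_0[OF lin] by fastforce
  then have "dim {x \<in> V. T x = 0} \<le> dim {x \<in> V. \<forall>w\<in>S ` V. \<beta> x w = 0}"
    by (rule dim_subset)
  moreover have "dim {x \<in> V. \<forall>w\<in>S ` V. \<beta> x w = 0} + dim (S ` V) \<le> dim V"
    by (rule dim_annihilator_le[OF lin linr nondeg V S(2)])
  moreover have "dim {x \<in> V. S x = 0} + dim (S ` V) = dim V"
    by (rule rank_nullity_on_subspace[OF S(1) V])
  ultimately show ?thesis by linarith
qed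

end


section \<open>Seaweeds are Lie algebras\<close>

lemma matrix_unit_nth [simp]: "matrix_unit i j $ k $ l = (if k = i \<and> l = j then 1 else 0)"
  by (simp add: matrix_unit_def)

lemma mscale_nth [simp]: "mscale c M $ i $ j = c * M $ i $ j"
  by (simp add: mscale_def)

lemma matrix_eq_sum_units:
  fixes M :: "complex^'n^'n"
  shows "M = (\<Sum>(i, j)\<in>UNIV. mscale (M $ i $ j) (matrix_unit i j))"
proof -
  have "(\<Sum>(i, j)\<in>UNIV. mscale (M $ i $ j) (matrix_unit i j)) $ k $ l = M $ k $ l" for k l
  proof -
    have "(\<Sum>(i, j)\<in>UNIV. mscale (M $ i $ j) (matrix_unit i j)) $ k $ l
        = (\<Sum>q\<in>UNIV. if q = (k, l) then M $ k $ l else 0)"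
      unfolding sum_component by (rule sum.cong) (auto split: prod.split)
    also have "\<dots> = M $ k $ l" by simp
    finally show ?thesis .
  qed
  then show ?thesis by (simp add: vec_eq_iff)
qed

global_interpretation sqmat: finite_dimensional_vector_space
  "mscale :: complex \<Rightarrow> complex^'n^'n \<Rightarrow> complex^'n^'n" "range (\<lambda>(i, j). matrix_unit i j)"
proof unfold_locales
  let ?U = "range (\<lambda>(i, j). matrix_unit i j) :: (complex^'n^'n) set"
  show "finite ?U" by simp
  have inj: "inj (\<lambda>(i, j). matrix_unit i j :: complex^'n^'n)"
    by (auto simp: inj_def matrix_unit_def vec_eq_iff split: if_splits)
  show "cmat.independent ?U"
  proof (rule cmat.independent_if_scalars_zero)
    fix u and M :: "complex^'n^'n"
    assume 0: "(\<Sum>x\<in>?U. mscale (u x) x) = 0" and "M \<in> ?U"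
    then obtain k l where M: "M = matrix_unit k l" by auto
    have "0 = (\<Sum>(i, j)\<in>UNIV. mscale (u (matrix_unit i j)) (matrix_unit i j)) $ k $ l"
      using 0 sum.reindex[OF inj, of "\<lambda>x. mscale (u x) x"] by (simp add: case_prod_unfold o_def)
    also have "\<dots> = (\<Sum>q\<in>UNIV. if q = (k, l) then u M else 0)"
      unfolding sum_component by (rule sum.cong) (auto simp: M split: prod.split)
    finally show "u M = 0" by simp
  qed simp
  show "cmat.span ?U = UNIV"
  proof -
    have "M \<in> cmat.span ?U" for M :: "complex^'n^'n"
    proof -
      have "(\<Sum>(i, j)\<in>UNIV. mscale (M $ i $ j) (matrix_unit i j)) \<in> cmat.span ?U"
        by (rule cmat.span_sum) (auto intro!: cmat.span_scale intro: cmat.span_base)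
      then show ?thesis by (simp only: matrix_eq_sum_units[symmetric])
    qed
    then show ?thesis by auto
  qed
qed

lemma block_of_mono: "r \<le> s \<Longrightarrow> block_of A r \<le> block_of A s"
  by (induction A r arbitrary: s rule: block_of.induct) auto

lemma same_block_refl: "same_block A i i"
  and same_block_sym: "same_block A i j \<Longrightarrow> same_block A j i"
  and same_block_trans: "same_block A i j \<Longrightarrow> same_block A j k \<Longrightarrow> same_block A i k"
  by (simp_all add: same_block_def)

lemma same_block_convex:
  assumes "same_block A i k" "i \<le> j" "j \<le> k"
  shows "same_block A i j" "same_block A j k"
proof -
  have "card {..<i} \<le> card {..<j}" "card {..<j} \<le> card {..<k}"
    using assms by (auto intro!: card_mono)
  then have "block_of A (card {..<i}) \<le> block_of A (card {..<j})"
    "block_of A (card {..<j}) \<le> block_of A (card {..<k})" by (auto intro: block_of_mono)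
  then show "same_block A i j" "same_block A j k" using assms(1) by (simp_all add: same_block_def)
qed

text \<open>
  Position \<open>(i, j)\<close> is open to nonzero entries of the seaweed.  The two implications overlap
  only on the diagonal, where both hold, so this is the usual condition written as a reflexive
  relation.
\<close>

definition seaweed_position :: "nat list \<Rightarrow> nat list \<Rightarrow> 'n::{finite,linorder} \<Rightarrow> 'n \<Rightarrow> bool" where
  "seaweed_position A B i j \<longleftrightarrow> (j \<le> i \<longrightarrow> same_block A i j) \<and> (i \<le> j \<longrightarrow> same_block B i j)"

text \<open>
  The steps \<open>i \<rightarrow> j \<rightarrow> k\<close> need to stay in a block only when they descend.  If \<open>j\<close> lies between
  the endpoints, both steps descend; if it lies outside, one descending step passes over the whole
  interval from \<open>k\<close> to \<open>i\<close>, and blocks are convex.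
\<close>

lemma same_block_chain:
  assumes "k \<le> i" "j \<le> i \<Longrightarrow> same_block C i j" "k \<le> j \<Longrightarrow> same_block C j k"
  shows "same_block C i k"
proof -
  consider "i \<le> j" | "j \<le> k" | "k \<le> j" "j \<le> i" by (meson linear)
  then show ?thesis
  proof cases
    case 1
    then have "same_block C k j" using assms by (auto intro: same_block_sym)
    then show ?thesis using same_block_convex(1)[of C k j i] assms(1) 1 same_block_sym by blast
  next
    case 2
    then have "same_block C j i" using assms by (auto intro: same_block_sym)
    then show ?thesis using same_block_convex(2)[of C j i k] assms(1) 2 same_block_sym by blast
  next
    case 3
    then show ?thesis using assms(2,3) same_block_trans by blast
  qed
qed

lemma seaweed_position_refl: "seaweed_position A B i i"
  by (simp add: seaweed_position_def same_block_refl)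

lemma seaweed_position_trans:
  assumes "seaweed_position A B i j" "seaweed_position A B j k"
  shows "seaweed_position A B i k"
  unfolding seaweed_position_def
proof (intro conjI impI)
  assume "k \<le> i"
  then show "same_block A i k"
    using assms by (intro same_block_chain[of k i j]) (auto simp: seaweed_position_def)
next
  assume "i \<le> k"
  then have "same_block B k i"
    using assms
    by (intro same_block_chain[of i k j]) (auto simp: seaweed_position_def intro: same_block_sym)
  then show "same_block B i k" by (rule same_block_sym)
qed

lemma trace_mscale: "trace (mscale c M) = c * trace M"
  by (simp add: trace_def sum_distrib_left)

text \<open>
  The description by forbidden entries makes closure under products a statement about the relation
  \<open>seaweed_position\<close> alone.
\<close>

lemma mem_seaweed_iff:
  fixes M :: "('a::{finite,linorder}) cmatrix"
  shows "M \<in> seaweed A B \<longleftrightarrow> trace M = 0 \<and> (\<forall>i j. M $ i $ j \<noteq> 0 \<longrightarrow> seaweed_position A B i j)"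
proof
  let ?G = "(traceless_diagonal :: 'a cmatrix set) \<union> {matrix_unit i j | i j. i > j \<and> same_block A i j}
      \<union> {matrix_unit i j | i j. i < j \<and> same_block B i j}"
  let ?P = "{M :: 'a cmatrix. trace M = 0 \<and> (\<forall>i j. M $ i $ j \<noteq> 0 \<longrightarrow> seaweed_position A B i j)}"
  have sub: "cmat.subspace ?P"
    unfolding cmat.subspace_def
  proof (intro conjI ballI allI)
    show "0 \<in> ?P" by (simp add: trace_def)
  next
    fix x y :: "'a cmatrix" assume xy: "x \<in> ?P" "y \<in> ?P"
    have "seaweed_position A B i j" if "(x + y) $ i $ j \<noteq> 0" for i j
      using that xy by (cases "x $ i $ j = 0") auto
    then show "x + y \<in> ?P" using xy by (simp add: trace_add)
  next
    fix c and x :: "'a cmatrix" assume "x \<in> ?P"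
    then show "mscale c x \<in> ?P" by (simp add: trace_mscale)
  qed
  have gen: "?G \<subseteq> ?P"
  proof
    fix x assume "x \<in> ?G"
    then consider "x \<in> traceless_diagonal" | i j where "x = matrix_unit i j" "i > j" "same_block A i j"
      | i j where "x = matrix_unit i j" "i < j" "same_block B i j" by blast
    then show "x \<in> ?P"
    proof cases
      case 1
      then have "seaweed_position A B i j" if "x $ i $ j \<noteq> 0" for i j
        using that seaweed_position_refl[of A B i] by (cases "i = j") (auto simp: traceless_diagonal_def)
      then show ?thesis
        using 1 by (simp add: traceless_diagonal_def)
    next
      case 2
      then show ?thesis by (auto simp: seaweed_position_def trace_def intro!: sum.neutral)
    next
      case 3
      then show ?thesis by (auto simp: seaweed_position_def trace_def intro!: sum.neutral)
    qed
  qed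
  show "M \<in> seaweed A B \<Longrightarrow> trace M = 0 \<and> (\<forall>i j. M $ i $ j \<noteq> 0 \<longrightarrow> seaweed_position A B i j)"
    using cmat.span_minimal[OF gen sub] unfolding seaweed_def by blast
  assume M: "trace M = 0 \<and> (\<forall>i j. M $ i $ j \<noteq> 0 \<longrightarrow> seaweed_position A B i j)"
  define D where "D = (\<chi> i j. if i = j then M $ i $ j else 0)"
  have "D \<in> traceless_diagonal"
    using M by (simp add: D_def traceless_diagonal_def trace_def)
  then have D: "D \<in> cmat.span ?G" by (auto intro: cmat.span_base)
  have E: "mscale ((M - D) $ i $ j) (matrix_unit i j) \<in> cmat.span ?G" for i j
  proof (cases "(M - D) $ i $ j = 0")
    case True then show ?thesis by (simp add: cmat.span_zero)
  next
    case False
    then have "i \<noteq> j" "M $ i $ j \<noteq> 0" by (auto simp: D_def split: if_splits)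
    then have "i > j \<and> same_block A i j \<or> i < j \<and> same_block B i j"
      using M by (cases i j rule: linorder_cases) (auto simp: seaweed_position_def)
    then have "matrix_unit i j \<in> ?G" by blast
    then show ?thesis by (intro cmat.span_scale cmat.span_base)
  qed
  have "M - D \<in> cmat.span ?G"
  proof -
    have "(\<Sum>(i, j)\<in>UNIV. mscale ((M - D) $ i $ j) (matrix_unit i j)) \<in> cmat.span ?G"
      by (rule cmat.span_sum) (use E in \<open>auto split: prod.split\<close>)
    then show ?thesis by (simp only: matrix_eq_sum_units[symmetric])
  qed
  then have "M - D + D \<in> cmat.span ?G" using D by (rule cmat.span_add)
  then show "M \<in> seaweed A B" by (simp add: seaweed_def)
qed

lemma subspace_seaweed: "cmat.subspace (seaweed A B)"
  by (simp add: seaweed_def)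

lemma bracket_seaweed:
  assumes "x \<in> seaweed A B" "y \<in> seaweed A B"
  shows "bracket x y \<in> seaweed A B"
proof -
  have prod: "seaweed_position A B i j"
    if "u \<in> seaweed A B" "v \<in> seaweed A B" "(u ** v) $ i $ j \<noteq> 0" for u v i j
  proof -
    have "(\<Sum>k\<in>UNIV. u $ i $ k * v $ k $ j) \<noteq> 0"
      using that(3) by (simp add: matrix_matrix_mult_def)
    then obtain k where "u $ i $ k * v $ k $ j \<noteq> 0"
      by (rule sum.not_neutral_contains_not_neutral)
    then show ?thesis
      using that(1,2) seaweed_position_trans[of A B i k j] by (auto simp: mem_seaweed_iff)
  qed
  have "trace (bracket x y) = 0"
    by (simp add: bracket_def trace_sub trace_mul_sym[of x y])
  moreover have "seaweed_position A B i j" if "bracket x y $ i $ j \<noteq> 0" for i j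
    using that prod assms unfolding bracket_def
    by (cases "(x ** y) $ i $ j = 0") auto
  ultimately show ?thesis by (simp add: mem_seaweed_iff)
qed


section \<open>Symmetry of the principal multiplicities\<close>

lemma mscale_mult:
  fixes M N :: "complex^'n^'n"
  shows "mscale c M ** N = mscale c (M ** N)" "M ** mscale c N = mscale c (M ** N)"
  by (simp_all add: vec_eq_iff matrix_matrix_mult_def sum_distrib_left mult.assoc mult.left_commute)

lemma matrix_add_rdistrib:
  fixes L M N :: "complex^'n^'n"
  shows "(L + M) ** N = L ** N + M ** N"
  by (simp add: vec_eq_iff matrix_matrix_mult_def distrib_right sum.distrib)

lemma linear_bracket_right: "Vector_Spaces.linear mscale mscale (bracket x)"
  by (simp add: Vector_Spaces.linear_iff cmat.vector_space_axioms bracket_def mscale_mult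
      matrix_add_ldistrib matrix_add_rdistrib cmat.scale_right_diff_distrib)

lemma linear_bracket_left: "Vector_Spaces.linear mscale mscale (\<lambda>x. bracket x y)"
  by (simp add: Vector_Spaces.linear_iff cmat.vector_space_axioms bracket_def mscale_mult
      matrix_add_ldistrib matrix_add_rdistrib cmat.scale_right_diff_distrib)

lemma bracket_Leibniz:
  "bracket H (bracket x y) = bracket (bracket H x) y + bracket x (bracket H y)"
proof -
  have sub: "(a - b) ** c = a ** c - b ** c" "c ** (a - b) = c ** a - c ** b"
    for a b c :: "complex^'n^'n"
    by (simp_all add: vec_eq_iff matrix_matrix_mult_def algebra_simps sum_subtractf)
  show ?thesis by (simp add: bracket_def sub matrix_mul_assoc)
qed

text \<open>
  Only the values on \<open>g\<close> of a functional are meaningful; a linear extension to all matrices makes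
  the Kirillov form bilinear on the whole space.
\<close>

lemma functional_extends:
  assumes g: "cmat.subspace g" and F: "functional_on g F"
  obtains F' where "Vector_Spaces.linear mscale (*) F'" "\<And>x. x \<in> g \<Longrightarrow> F' x = F x"
proof -
  interpret pair: vector_space_pair "mscale :: complex \<Rightarrow> complex^'a^'a \<Rightarrow> _" "(*) :: complex \<Rightarrow> _"
    by unfold_locales
  obtain E where E: "E \<subseteq> g" "cmat.independent E" "g \<subseteq> cmat.span E"
    by (rule cmat.basis_exists)
  obtain F' where F': "Vector_Spaces.linear mscale (*) F'" "\<And>x. x \<in> E \<Longrightarrow> F' x = F x"
    using pair.linear_independent_extend[OF E(2), of F] by blast
  have F0: "F 0 = 0"
    using F cmat.subspace_0[OF g] unfolding functional_on_def
    by (metis cmat.scale_zero_left mult_zero_left)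
  have "x \<in> g \<and> F' x = F x" if "x \<in> cmat.span E" for x
    using that
  proof (induction rule: cmat.span_induct_alt)
    case base
    show ?case using F0 pair.linear_0[OF F'(1)] cmat.subspace_0[OF g] by simp
  next
    case (step c x y)
    have "x \<in> g" "mscale c x \<in> g" using step E(1) cmat.subspace_scale[OF g] by auto
    then show ?case
      using step F F'(2)[of x] cmat.subspace_add[OF g] unfolding functional_on_def
      by (simp add: pair.linear_add[OF F'(1)] pair.linear_scale[OF F'(1)])
  qed
  then show ?thesis using that F'(1) E(3) by blast
qed

text \<open>
  The inequality between the kernels of the adjoint pair \<open>ad H - k\<close> and \<open>(1 - k) - ad H\<close>, used
  for \<open>k = j\<close> and \<open>k = 1 - j\<close>, gives the equality.
\<close>

theorem principal_multiplicity_symmetric: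
  assumes g: "cmat.subspace g" and closed: "\<And>x y. x \<in> g \<Longrightarrow> y \<in> g \<Longrightarrow> bracket x y \<in> g"
    and F: "Frobenius_functional g F"
  shows "principal_multiplicity g F (1 - j) = principal_multiplicity g F j"
proof -
  interpret pair: vector_space_pair "mscale :: complex \<Rightarrow> complex^'a^'a \<Rightarrow> _" "(*) :: complex \<Rightarrow> _"
    by unfold_locales
  interpret mpair: vector_space_pair "mscale :: complex \<Rightarrow> complex^'a^'a \<Rightarrow> _"
      "mscale :: complex \<Rightarrow> complex^'a^'a \<Rightarrow> _"
    by unfold_locales
  obtain F' where F': "Vector_Spaces.linear mscale (*) F'" "\<And>x. x \<in> g \<Longrightarrow> F' x = F x"
    using functional_extends[OF g] F unfolding Frobenius_functional_def by blast
  define \<beta> where "\<beta> x y = F' (bracket x y)" for x y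
  have lin: "Vector_Spaces.linear mscale (*) (\<lambda>x. \<beta> x y)" for y
    unfolding \<beta>_def
    using Vector_Spaces.linear_compose[OF linear_bracket_left F'(1)] by (simp add: o_def)
  have linr: "Vector_Spaces.linear mscale (*) (\<beta> x)" for x
    unfolding \<beta>_def
    using Vector_Spaces.linear_compose[OF linear_bracket_right F'(1)] by (simp add: o_def)
  have nondeg: "x = 0" if "x \<in> g" "\<forall>y\<in>g. \<beta> x y = 0" for x
    using F that closed F'(2) unfolding Frobenius_functional_def kirillov_def \<beta>_def by auto
  obtain z where z: "z \<in> g" "\<And>y. y \<in> g \<Longrightarrow> \<beta> z y = F' y"
    using sqmat.functional_represented[OF lin linr nondeg g F'(1)] by blast
  define H where "H = principal_element g F"
  \<comment> \<open>\<open>H\<close> represents \<open>F\<close> through the Kirillov form; nondegeneracy makes it unique\<close>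
  have "H \<in> g \<and> (\<forall>x\<in>g. F (bracket H x) = F x)"
    unfolding H_def principal_element_def
  proof (rule theI)
    show "z \<in> g \<and> (\<forall>x\<in>g. F (bracket z x) = F x)"
      using z closed F'(2) by (auto simp: \<beta>_def)
  next
    fix w assume w: "w \<in> g \<and> (\<forall>x\<in>g. F (bracket w x) = F x)"
    have "\<beta> (w - z) y = 0" if "y \<in> g" for y
      using w z(2)[OF that] closed F'(2) that
      by (simp add: pair.linear_diff[OF lin]) (simp add: \<beta>_def)
    then show "w = z" using nondeg[of "w - z"] w z(1) cmat.subspace_diff[OF g] by auto
  qed
  then have H: "H \<in> g" "\<And>x. x \<in> g \<Longrightarrow> F' (bracket H x) = F' x"
    using closed F'(2) by auto
  define T where "T k x = bracket H x - mscale (of_int k) x" for k :: int and x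
  have linT: "Vector_Spaces.linear mscale mscale (T k)" for k
    unfolding T_def
    by (intro mpair.linear_compose_sub linear_bracket_right cmat.linear_scale_self)
  have T_in: "T k ` g \<subseteq> g" for k
  proof (rule image_subsetI)
    fix x assume "x \<in> g"
    then show "T k x \<in> g"
      unfolding T_def
      by (intro cmat.subspace_diff[OF g] cmat.subspace_scale[OF g] closed H(1))
  qed
  have adj: "\<beta> (T k x) y = \<beta> x (mscale (- 1) (T (1 - k) y))" if "x \<in> g" "y \<in> g" for k x y
  proof -
    have "\<beta> (bracket H x) y + \<beta> x (bracket H y) = \<beta> x y"
      using H(2)[OF closed[OF that]]
      by (simp only: \<beta>_def bracket_Leibniz[of H] pair.linear_add[OF F'(1)])
    moreover have "\<beta> (T k x) y = \<beta> (bracket H x) y - of_int k * \<beta> x y"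
      by (simp only: T_def pair.linear_diff[OF lin] pair.linear_scale[OF lin])
    moreover have "\<beta> x (mscale (- 1) (T (1 - k) y)) = of_int (1 - k) * \<beta> x y - \<beta> x (bracket H y)"
      by (simp add: T_def pair.linear_diff[OF linr] pair.linear_scale[OF linr])
    ultimately show ?thesis by (simp add: left_diff_distrib) (simp add: eq_diff_eq diff_eq_eq)
  qed
  have eig: "principal_multiplicity g F k = cmat.dim {x \<in> g. T k x = 0}" for k
    by (simp add: principal_multiplicity_def principal_eigenspace_def T_def H_def)
  have le: "principal_multiplicity g F k \<le> principal_multiplicity g F (1 - k)" for k
  proof -
    \<comment> \<open>the sign turns \<open>ad H - (1 - k)\<close> into the adjoint of \<open>T k\<close> without changing its kernel\<close>
    let ?S = "\<lambda>x. mscale (- 1) (T (1 - k) x)"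
    have S: "Vector_Spaces.linear mscale mscale ?S"
      by (intro mpair.linear_compose_scale_right linT)
    have S_in: "?S ` g \<subseteq> g" using T_in[of "1 - k"] cmat.subspace_scale[OF g] by blast
    have "cmat.dim {x \<in> g. T k x = 0} \<le> cmat.dim {x \<in> g. ?S x = 0}"
    proof (rule sqmat.dim_kernel_le_adjoint[where \<beta> = \<beta> and V = g and S = ?S and T = "T k"])
      show "\<beta> (T k x) y = \<beta> x (?S y)" if "x \<in> g" "y \<in> g" for x y
        using that by (rule adj)
    qed (fact lin linr g S S_in | erule (1) nondeg)+
    then show ?thesis by (simp add: eig)
  qed
  show ?thesis using le[of j] le[of "1 - j"] by simp
qed


section \<open>Symmetric multiplicity functions\<close>

lemma support_symmetric:
  fixes h :: "int \<Rightarrow> nat"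
  assumes sym: "\<And>j. h (1 - j) = h j" and top: "\<And>j. j > int N \<Longrightarrow> h j = 0"
  shows "{j. h j \<noteq> 0} \<subseteq> {1 - int N..int N}"
proof
  fix j assume "j \<in> {j. h j \<noteq> 0}"
  then have "\<not> j > int N" "\<not> 1 - j > int N" using top[of j] top[of "1 - j"] sym[of j] by auto
  then show "j \<in> {1 - int N..int N}" by simp
qed

lemma tail_sum_differences:
  fixes h :: "int \<Rightarrow> nat"
  assumes "h (int N + 1) = 0" "j \<le> N"
  shows "(\<Sum>m = j..N. int (h (int m)) - int (h (int m + 1))) = int (h (int j))"
proof -
  have "(\<Sum>m = j..N. int (h (int m)) - int (h (int m + 1)))
      = - (\<Sum>m = j..N. int (h (int (Suc m))) - int (h (int m)))"
    by (simp add: sum_negf[symmetric] add.commute)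
  also have "\<dots> = int (h (int j)) - int (h (int (Suc N)))"
    using assms(2) by (subst sum_Suc_diff) auto
  finally show ?thesis using assms(1) by (simp add: add.commute)
qed

lemma sl2_char_odd:
  assumes "1 \<le> m"
  shows "sl2_char (2 * m - 1) = (\<Sum>j = 1 - int m..int m. Poly_Mapping.single (2 * j - 1) 1)"
  unfolding sl2_char_def
  by (rule sum.reindex_bij_witness[where j = "\<lambda>k. int m - int k" and i = "\<lambda>j. nat (int m - j)"])
    (use assms in \<open>auto simp: of_nat_diff algebra_simps\<close>)

lemma single_sum: "Poly_Mapping.single k (sum f A) = (\<Sum>a\<in>A. Poly_Mapping.single k (f a))"
  by (induction A rule: infinite_finite_induct) (simp_all add: single_add)

text \<open>
  Exchanging the order of summation, the coefficient of weight \<open>2 * j - 1\<close> collects the \<open>p m\<close>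
  with \<open>j \<in> {1 - m..m}\<close>, that is \<open>m \<ge> max j (1 - j)\<close>.  This tail sum is the multiplicity at
  \<open>max j (1 - j)\<close>, which is the one at \<open>j\<close> by symmetry.
\<close>

lemma Theta_eq_sum_sl2_char:
  assumes sym: "\<And>j. h (1 - j) = h j" and top: "\<And>j. j > int N \<Longrightarrow> h j = 0"
  shows "Theta h = (\<Sum>m = 1..N. of_int (int (h (int m)) - int (h (int m + 1))) * sl2_char (2 * m - 1))"
    (is "_ = (\<Sum>m = 1..N. of_int (?p m) * _)")
proof -
  let ?J = "{1 - int N..int N}"
  have coeff: "(\<Sum>m\<in>{m\<in>{1..N}. j \<in> {1 - int m..int m}}. ?p m) = int (h j)" if "j \<in> ?J" for j
  proof -
    define k where "k = nat (max j (1 - j))"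
    have k: "1 \<le> k" "k \<le> N" "int k = max j (1 - j)" using that by (auto simp: k_def)
    have "{m\<in>{1..N}. j \<in> {1 - int m..int m}} = {k..N}" using k by auto
    then have "(\<Sum>m\<in>{m\<in>{1..N}. j \<in> {1 - int m..int m}}. ?p m) = int (h (int k))"
      using tail_sum_differences[of h N k] k(2) top[of "int N + 1"] by simp
    then show ?thesis using sym[of j] k(3) by (simp add: max_def split: if_splits)
  qed
  have summand: "of_int (?p m) * sl2_char (2 * m - 1)
      = (\<Sum>j\<in>{j\<in>?J. j \<in> {1 - int m..int m}}. Poly_Mapping.single (2 * j - 1) (?p m))"
    if "m \<in> {1..N}" for m
  proof -
    have "of_int c * Poly_Mapping.single k 1 = Poly_Mapping.single k c" for c k :: int
      using single_of_int[of c, where 'a = int and 'b = int, symmetric]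
      by (simp add: mult_single del: single_of_int)
    moreover have "{j\<in>?J. j \<in> {1 - int m..int m}} = {1 - int m..int m}" using that by auto
    ultimately show ?thesis
      using that by (simp only: sl2_char_odd sum_distrib_left atLeastAtMost_iff)
  qed
  have "Theta h = (\<Sum>j\<in>?J. Poly_Mapping.single (2 * j - 1) (int (h j)))"
    unfolding Theta_def
    by (rule sum.mono_neutral_left) (use support_symmetric[of h N, OF sym top] in auto)
  also have "\<dots> = (\<Sum>j\<in>?J. \<Sum>m\<in>{m\<in>{1..N}. j \<in> {1 - int m..int m}}.
      Poly_Mapping.single (2 * j - 1) (?p m))"
    by (rule sum.cong[OF refl]) (simp only: coeff[symmetric] single_sum)
  also have "\<dots> = (\<Sum>m\<in>{1..N}. \<Sum>j\<in>{j\<in>?J. j \<in> {1 - int m..int m}}.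
      Poly_Mapping.single (2 * j - 1) (?p m))"
    by (rule sum.swap_restrict) auto
  also have "\<dots> = (\<Sum>m = 1..N. of_int (?p m) * sl2_char (2 * m - 1))"
    by (rule sum.cong[OF refl], rule summand[symmetric])
  finally show ?thesis .
qed

lemma odd_mem_keys_Theta_iff:
  assumes "finite {j. h j \<noteq> 0}"
  shows "2 * j - 1 \<in> Poly_Mapping.keys (Theta h) \<longleftrightarrow> h j \<noteq> 0"
proof -
  have "Poly_Mapping.lookup (Theta h) (2 * j - 1) = (\<Sum>i | h i \<noteq> 0. if i = j then int (h i) else 0)"
    unfolding Theta_def lookup_sum by (rule sum.cong) (auto simp: lookup_single when_def)
  also have "\<dots> = int (h j)" using assms by simp
  finally show ?thesis by (simp add: in_keys_iff)
qed

lemma has_odd_weights_Theta_iff: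
  assumes sym: "\<And>j. h (1 - j) = h j" and top: "\<And>j. j > int N \<Longrightarrow> h j = 0"
  shows "has_odd_weights (Theta h) N \<longleftrightarrow> (\<forall>j\<in>{1..int N}. h j \<noteq> 0)"
proof -
  have fin: "finite {j. h j \<noteq> 0}"
    using support_symmetric[of h N, OF sym top] by (rule finite_subset) auto
  have "has_odd_weights (Theta h) N \<longleftrightarrow> (\<forall>j\<in>{1 - int N..int N}. 2 * j - 1 \<in> Poly_Mapping.keys (Theta h))"
    (is "?L \<longleftrightarrow> ?R")
  proof
    assume R: ?R
    show ?L
      unfolding has_odd_weights_def
    proof (intro allI impI)
      fix w assume w: "odd w \<and> - (2 * int N - 1) \<le> w \<and> w \<le> 2 * int N - 1"
      then obtain k where k: "w = 2 * k + 1" by (auto elim: oddE)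
      then have "k + 1 \<in> {1 - int N..int N}" using w by auto
      with R have "2 * (k + 1) - 1 \<in> Poly_Mapping.keys (Theta h)" by blast
      moreover have "2 * (k + 1) - 1 = w" using k by simp
      ultimately show "w \<in> Poly_Mapping.keys (Theta h)" by metis
    qed
  qed (auto simp: has_odd_weights_def)
  also have "\<dots> \<longleftrightarrow> (\<forall>j\<in>{1 - int N..int N}. h j \<noteq> 0)"
    using odd_mem_keys_Theta_iff[OF fin] by simp
  also have "\<dots> \<longleftrightarrow> (\<forall>j\<in>{1..int N}. h j \<noteq> 0)" (is "?L \<longleftrightarrow> ?R")
  proof
    assume R: ?R
    show ?L
    proof
      fix j assume "j \<in> {1 - int N..int N}"
      then have "j \<in> {1..int N} \<or> 1 - j \<in> {1..int N}" by auto
      then show "h j \<noteq> 0" using R sym[of j] by metis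
    qed
  qed auto
  finally show ?thesis .
qed

lemma largest_eigenvalue_unique:
  assumes "largest_eigenvalue h M" "largest_eigenvalue h N"
  shows "M = N"
  using assms unfolding largest_eigenvalue_def by (metis linorder_neqE_nat of_nat_less_iff gr0I not_less0 gr_implies_not0)

lemma strictly_unimodal_iff:
  assumes "largest_eigenvalue h N"
  shows "strictly_unimodal h \<longleftrightarrow> (\<forall>m\<in>{1..N}. int (h (int m)) - int (h (int m + 1)) > 0)"
proof -
  have top: "h (int N + 1) = 0" "0 < N \<Longrightarrow> h (int N) > 0"
    using assms by (auto simp: largest_eigenvalue_def)
  have "strictly_unimodal h \<longleftrightarrow> (\<forall>j. 1 \<le> j \<and> j < int N \<longrightarrow> h j > h (j + 1))"
    using assms largest_eigenvalue_unique[OF assms] top(2) unfolding strictly_unimodal_def by blast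
  also have "\<dots> \<longleftrightarrow> (\<forall>m\<in>{1..N}. int (h (int m)) - int (h (int m + 1)) > 0)"
  proof safe
    fix m assume *: "\<forall>j. 1 \<le> j \<and> j < int N \<longrightarrow> h j > h (j + 1)" "m \<in> {1..N}"
    then show "0 < int (h (int m)) - int (h (int m + 1))"
      using *(1)[rule_format, of "int m"] top by (cases "m = N") auto
  next
    fix j assume *: "\<forall>m\<in>{1..N}. 0 < int (h (int m)) - int (h (int m + 1))" "1 \<le> j" "j < int N"
    then have "nat j \<in> {1..N}" by auto
    with *(1) have "0 < int (h (int (nat j))) - int (h (int (nat j) + 1))" by blast
    then show "h (j + 1) < h j" using *(2) by simp
  qed
  finally show ?thesis .
qed


theorem corollary2p2:
  fixes A B :: "nat list"
    and g :: "('n::{finite,linorder}) cmatrix set"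
    and F :: "'n cmatrix \<Rightarrow> complex"
    and h :: "int \<Rightarrow> nat"
    and p :: "nat \<Rightarrow> int"
  assumes "composition CARD('n) A" and "composition CARD('n) B"
    and "g = seaweed A B"
    and "Frobenius g"
    and "Frobenius_functional g F"
    and "h = principal_multiplicity g F"
    and "p = (\<lambda>m. int (h (int m)) - int (h (int m + 1)))"
  shows
    "(\<forall>N::nat. positive_support h = {1..int N} \<longrightarrow>
        h (int N + 1) = 0 \<and>
        Theta h = (\<Sum>m = 1..N. of_int (p m) * sl2_char (2 * m - 1)) \<and>
        (\<forall>j\<in>{1..N}. int (h (int j)) = (\<Sum>m = j..N. p m) \<and> (\<Sum>m = j..N. p m) > 0) \<and>
        has_odd_weights (Theta h) N) \<and>
     (\<forall>N::nat. largest_eigenvalue h N \<longrightarrow>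
        (unbroken h \<longleftrightarrow> positive_support h = {1..int N}) \<and>
        (unbroken h \<longleftrightarrow> (\<forall>j\<in>{1..N}. (\<Sum>m = j..N. p m) > 0)) \<and>
        (unbroken h \<longleftrightarrow> has_odd_weights (Theta h) N) \<and>
        (strictly_unimodal h \<longleftrightarrow> (\<forall>m\<in>{1..N}. p m > 0)) \<and>
        (strictly_unimodal h \<longrightarrow> unbroken h))"
proof -
  have sym: "h (1 - j) = h j" for j
    unfolding assms(6,3)
    by (rule principal_multiplicity_symmetric[OF subspace_seaweed bracket_seaweed])
      (use assms(3,5) in auto)
  have tail: "(\<Sum>m = j..N. p m) = int (h (int j))" if "h (int N + 1) = 0" "j \<le> N" for j N
    unfolding assms(7) by (rule tail_sum_differences[of h, OF that])
  show ?thesis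
  proof (intro conjI allI impI)
    fix N assume supp: "positive_support h = {1..int N}"
    have top: "h j = 0" if "j > int N" for j
    proof -
      have "j \<notin> positive_support h" using that unfolding supp by simp
      then show ?thesis using that by (simp add: positive_support_def)
    qed
    have pos: "h j \<noteq> 0" if "j \<in> {1..int N}" for j
      using supp that unfolding positive_support_def by blast
    show 0: "h (int N + 1) = 0" using top by simp
    show "Theta h = (\<Sum>m = 1..N. of_int (p m) * sl2_char (2 * m - 1))"
      unfolding assms(7) by (rule Theta_eq_sum_sl2_char[of h N, OF sym top])
    show "\<forall>j\<in>{1..N}. int (h (int j)) = (\<Sum>m = j..N. p m) \<and> (\<Sum>m = j..N. p m) > 0"
      using tail[OF 0] pos by force
    show "has_odd_weights (Theta h) N"
      using has_odd_weights_Theta_iff[of h N, OF sym top] pos by blast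
  next
    fix N assume N: "largest_eigenvalue h N"
    have top: "h j = 0" if "j > int N" for j
      using N that by (auto simp: largest_eigenvalue_def)
    have supp: "positive_support h = {1..int N} \<longleftrightarrow> (\<forall>j\<in>{1..int N}. h j \<noteq> 0)"
    proof -
      have "h j \<noteq> 0 \<Longrightarrow> j \<le> int N" for j using top[of j] by (cases "j \<le> int N") auto
      then show ?thesis unfolding positive_support_def by auto
    qed
    show unb: "unbroken h \<longleftrightarrow> positive_support h = {1..int N}"
    proof
      assume "unbroken h"
      then obtain M where M: "positive_support h = {1..int M}" unfolding unbroken_def by blast
      have *: "h j \<noteq> 0 \<longleftrightarrow> j \<le> int M" if "1 \<le> j" for j
      proof -
        have "j \<in> positive_support h \<longleftrightarrow> j \<in> {1..int M}" unfolding M by (rule refl)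
        then show ?thesis using that by (simp add: positive_support_def)
      qed
      have "h j = 0" if "j > int M" for j using *[of j] that by simp
      moreover have "h (int M) \<noteq> 0" if "0 < M" using *[of "int M"] that by simp
      ultimately have "largest_eigenvalue h M" by (simp add: largest_eigenvalue_def)
      then show "positive_support h = {1..int N}"
        using M largest_eigenvalue_unique[OF N] by blast
    qed (auto simp: unbroken_def)
    have ball: "(\<forall>j\<in>{1..int N}. h j \<noteq> 0) \<longleftrightarrow> (\<forall>j\<in>{1..N}. (\<Sum>m = j..N. p m) > 0)"
    proof -
      have "(\<forall>j\<in>{1..int N}. h j \<noteq> 0) \<longleftrightarrow> (\<forall>j\<in>{1..N}. h (int j) \<noteq> 0)"
      proof
        assume L: "\<forall>j\<in>{1..int N}. h j \<noteq> 0"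
        show "\<forall>j\<in>{1..N}. h (int j) \<noteq> 0"
        proof
          fix j assume "j \<in> {1..N}"
          then have "int j \<in> {1..int N}" by simp
          with L show "h (int j) \<noteq> 0" by blast
        qed
      next
        assume R: "\<forall>j\<in>{1..N}. h (int j) \<noteq> 0"
        show "\<forall>j\<in>{1..int N}. h j \<noteq> 0"
        proof
          fix j assume "j \<in> {1..int N}"
          then have "nat j \<in> {1..N}" "int (nat j) = j" by auto
          then show "h j \<noteq> 0" using R by metis
        qed
      qed
      also have "\<dots> \<longleftrightarrow> (\<forall>j\<in>{1..N}. (\<Sum>m = j..N. p m) > 0)"
        using tail[of N] top[of "int N + 1"] by (intro ball_cong) auto
      finally show ?thesis .
    qed
    show tails: "unbroken h \<longleftrightarrow> (\<forall>j\<in>{1..N}. (\<Sum>m = j..N. p m) > 0)"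
      using unb supp ball by blast
    show "unbroken h \<longleftrightarrow> has_odd_weights (Theta h) N"
      using unb supp has_odd_weights_Theta_iff[of h N, OF sym top] by blast
    show su: "strictly_unimodal h \<longleftrightarrow> (\<forall>m\<in>{1..N}. p m > 0)"
      unfolding assms(7) by (rule strictly_unimodal_iff[OF N])
    assume "strictly_unimodal h"
    with su have pos: "p m > 0" if "m \<in> {1..N}" for m using that by blast
    have "\<forall>j\<in>{1..N}. (\<Sum>m = j..N. p m) > 0"
    proof
      fix j assume "j \<in> {1..N}"
      then show "(\<Sum>m = j..N. p m) > 0" by (intro sum_pos pos) auto
    qed
    then show "unbroken h" using tails by blast
  qed
qed

end
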